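(* Let $a_1,\dots,a_n$ be distinct points of $\mathbb{C}$ and let $V$ be a nonempty simply connected open subset of $\mathbb{C}\setminus\{a_1,\dots,a_n\}$. Let $X=\{x_1,\dots,x_n\}$ and $$M=\sum_{i=1}^n\frac{\lambda_i\,x_i}{z-a_i},\qquad \lambda_i\in\mathbb{C}\setminus\{0\}\ \text{for all } i.$$ Let $S\in\mathcal{H}\langle\!\langle X\rangle\!\rangle$, where $\mathcal{H}$ is the algebra of holomorphic functions on $V$, be any regular solution of $\frac{d}{dz}S=MS$. Let $\mathcal{C}$ be a differential field of germs on $V$ (with filter basis $\mathcal{B}$) which contains the function $z$ and the constants, and which contains no linear combination of logarithms on any domain: for no $U\in\mathcal{B}$ does $\mathcal{C}[U]$ contain a function of the form $z\mapsto c+\sum_{i=1}^n c_i\log(z-a_i)$ (any branch on $U$) with $c,c_i\in\mathbb{C}$ and $(c_1,\dots,c_n)\neq 0$. Then for every $U\in\mathcal{B}$ and every $P\in\mathcal{C}[U]\langle X\rangle$, $$\langle S\mid P\rangle=0\ \Longrightarrow\ P=0.$$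
   Context: $X^*$ is the free monoid on $X$ with empty word $1_{X^*}$; $R\langle\!\langle X\rangle\!\rangle$ denotes noncommutative formal power series $S=\sum_{w\in X^*}\langle S\mid w\rangle w$ with coefficients in $R$ and $R\langle X\rangle$ noncommutative polynomials; $\langle S\mid P\rangle=\sum_w\langle S\mid w\rangle\langle P\mid w\rangle$ (a function on the common domain). $\frac{d}{dz}$ acts on series coefficientwise. A solution $S$ is called regular if its constant term $\langle S\mid 1_{X^*}\rangle$ is nonzero (e.g. equal to $1$). A differential field of germs on $V$ consists of a filter basis $\mathcal{B}$ of open connected subsets of $V$ and, for each $U\in\mathcal{B}$, a subring $\mathcal{C}[U]$ of the ring of holomorphic functions on $U$, stable under $d/dz$, such that: (1) if $U,W\in\mathcal{B}$ with $W\subset U$ then the restriction to $W$ maps $\mathcal{C}[U]$ into $\mathcal{C}[W]$; (2) if $f\in\mathcal{C}[U]\setminus\{0\}$ then there is $W\in\mathcal{B}$ with $W\subset U\setminus\mathcal{O}_f$ ($\mathcal{O}_f$ the zero set of $f$) such that $f^{-1}$ restricted to $W$ belongs to $\mathcal{C}[W]$. *)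

theory Defs
  imports "HOL-Complex_Analysis.Complex_Analysis" "HOL-Library.Function_Algebras"
begin

text \<open>
  The alphabet is a finite type \<open>'x\<close>, one letter per singular point, so that words are
  lists and \<open>1\<^sub>X\<^sub>*\<close> is \<open>[]\<close>. A series is its coefficient function. Coefficient rings of
  functions carry the pointwise ring structure of \<open>Function_Algebras\<close>; that theory also
  provides a pointwise \<open>*\<close> on series, which is not the concatenation product \<open>nc_mult\<close>.

  A holomorphic function on an open set \<open>U\<close> is represented by any total function with the given
  values on \<open>U\<close>; equality in the ring of functions on \<open>U\<close> is therefore equality on \<open>U\<close>.
\<close>

type_synonym ('x, 'r) ncseries = "'x list \<Rightarrow> 'r"

definition nc_monomial :: "'r::zero \<Rightarrow> 'x list \<Rightarrow> ('x, 'r) ncseries" where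
  "nc_monomial c u = (\<lambda>w. if w = u then c else 0)"

definition nc_mult ::
    "('x, 'r::semiring_0) ncseries \<Rightarrow> ('x, 'r) ncseries \<Rightarrow> ('x, 'r) ncseries" where
  "nc_mult S T = (\<lambda>w. \<Sum>k\<le>length w. S (take k w) * T (drop k w))"

definition nc_polynomial :: "('x, 'r::zero) ncseries \<Rightarrow> bool" where
  "nc_polynomial P \<longleftrightarrow> finite {w. P w \<noteq> 0}"

definition nc_pairing ::
    "('x, 'r::semiring_0) ncseries \<Rightarrow> ('x, 'r) ncseries \<Rightarrow> 'r" where
  "nc_pairing S P = (\<Sum>w | P w \<noteq> 0. S w * P w)"

definition nc_deriv ::
    "('x, complex \<Rightarrow> complex) ncseries \<Rightarrow> ('x, complex \<Rightarrow> complex) ncseries" where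
  "nc_deriv S = (\<lambda>w. deriv (S w))"

definition log_multiplier ::
    "('x::finite \<Rightarrow> complex) \<Rightarrow> ('x \<Rightarrow> complex) \<Rightarrow> ('x, complex \<Rightarrow> complex) ncseries" where
  "log_multiplier a l = (\<Sum>i\<in>UNIV. nc_monomial (\<lambda>z. l i / (z - a i)) [i])"

definition nc_solution_on ::
    "complex set \<Rightarrow> ('x, complex \<Rightarrow> complex) ncseries \<Rightarrow> ('x, complex \<Rightarrow> complex) ncseries \<Rightarrow> bool"
where
  "nc_solution_on V M S \<longleftrightarrow>
     (\<forall>w. S w holomorphic_on V) \<and> (\<forall>w. \<forall>z\<in>V. nc_deriv S w z = nc_mult M S w z)"

definition regular_on :: "complex set \<Rightarrow> ('x, complex \<Rightarrow> complex) ncseries \<Rightarrow> bool" where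
  "regular_on V S \<longleftrightarrow> (\<exists>z\<in>V. S [] z \<noteq> 0)"

definition filter_basis :: "'a set set \<Rightarrow> bool" where
  "filter_basis B \<longleftrightarrow>
     B \<noteq> {} \<and> {} \<notin> B \<and> (\<forall>U\<in>B. \<forall>W\<in>B. \<exists>T\<in>B. T \<subseteq> U \<inter> W)"

text \<open>
  The condition that \<open>C U\<close> is closed under changing a function outside \<open>U\<close> makes it correspond to
  a set of functions on \<open>U\<close>; restriction from \<open>U\<close> to \<open>W\<close> is then the identity on representatives.
\<close>

definition differential_field_of_germs ::
    "complex set \<Rightarrow> complex set set \<Rightarrow> (complex set \<Rightarrow> (complex \<Rightarrow> complex) set) \<Rightarrow> bool" where
  "differential_field_of_germs V B C \<longleftrightarrow>
     filter_basis B \<and>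
     (\<forall>U\<in>B. open U \<and> connected U \<and> U \<subseteq> V) \<and>
     (\<forall>U\<in>B. \<forall>f\<in>C U. \<forall>g. (\<forall>z\<in>U. g z = f z) \<longrightarrow> g \<in> C U) \<and>
     (\<forall>U\<in>B. \<forall>f\<in>C U. f holomorphic_on U) \<and>
     (\<forall>U\<in>B. 1 \<in> C U) \<and>
     (\<forall>U\<in>B. \<forall>f\<in>C U. \<forall>g\<in>C U. f - g \<in> C U \<and> f * g \<in> C U) \<and>
     (\<forall>U\<in>B. \<forall>f\<in>C U. deriv f \<in> C U) \<and>
     (\<forall>U\<in>B. \<forall>W\<in>B. W \<subseteq> U \<longrightarrow> C U \<subseteq> C W) \<and>
     (\<forall>U\<in>B. \<forall>f\<in>C U. (\<exists>z\<in>U. f z \<noteq> 0) \<longrightarrow>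
        (\<exists>W\<in>B. W \<subseteq> U - {z. f z = 0} \<and> (\<lambda>z. inverse (f z)) \<in> C W))"

definition log_branch_on :: "complex set \<Rightarrow> complex \<Rightarrow> (complex \<Rightarrow> complex) \<Rightarrow> bool" where
  "log_branch_on U a L \<longleftrightarrow> L holomorphic_on U \<and> (\<forall>z\<in>U. exp (L z) = z - a)"

end

theory Submission
  imports Defs
begin

text \<open>
  Differentiating \<open>\<langle>S | P\<rangle> = 0\<close> gives \<open>\<langle>S | Q\<rangle> = 0\<close> with
  \<open>Q\<^sub>w = P\<^sub>w' + (\<Sum>i. l\<^sub>i / (z - a\<^sub>i) P\<^sub>i\<^sub>w)\<close>. If a longest word of \<open>P\<close> has been normalised to have
  coefficient \<open>1\<close>, which costs a shrinking of the domain, that word disappears from \<open>Q\<close> and no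
  longer word appears, so \<open>Q = 0\<close> by induction. Hence the coefficients of the words of maximal
  length are constants \<open>c\<^sub>u\<close>, and the coefficient of a word \<open>w\<close> one letter shorter has derivative
  \<open>- (\<Sum>i. l\<^sub>i c\<^sub>i\<^sub>w / (z - a\<^sub>i))\<close>: it is a combination of logarithms, which \<open>\<C>\<close> excludes.
\<close>

section \<open>Coefficients of the multiplier and of its product with a series\<close>

lemma sum_fun_apply: "(sum f A) x = (\<Sum>i\<in>A. f i x)"
  by (induction A rule: infinite_finite_induct) auto

lemma log_multiplier_Nil: "log_multiplier a l [] = 0"
  by (rule ext) (simp add: log_multiplier_def sum_fun_apply nc_monomial_def)

lemma log_multiplier_single: "log_multiplier a l [i] z = l i / (z - a i)"
proof -
  have "log_multiplier a l [i] z = (\<Sum>j\<in>UNIV. if j = i then l i / (z - a i) else 0)"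
    unfolding log_multiplier_def sum_fun_apply nc_monomial_def
    by (rule sum.cong) auto
  then show ?thesis by simp
qed

lemma log_multiplier_longer: "length w > 1 \<Longrightarrow> log_multiplier a l w = 0"
  by (rule ext) (auto simp: log_multiplier_def sum_fun_apply nc_monomial_def intro!: sum.neutral)

lemma nc_mult_log_multiplier_Nil: "nc_mult (log_multiplier a l) S [] z = 0"
  by (simp add: nc_mult_def log_multiplier_Nil)

text \<open>The multiplier is supported on words of length one, so only the cut after the first
  letter of \<open>i # w\<close> contributes.\<close>

lemma nc_mult_log_multiplier_Cons:
  "nc_mult (log_multiplier a l) S (i # w) z = l i / (z - a i) * S w z"
proof -
  have "nc_mult (log_multiplier a l) S (i # w) z =
      (\<Sum>k\<le>Suc (length w). log_multiplier a l (take k (i # w)) z * S (drop k (i # w)) z)"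
    by (simp add: nc_mult_def sum_fun_apply)
  also have "\<dots> = (\<Sum>k\<in>{1}. log_multiplier a l (take k (i # w)) z * S (drop k (i # w)) z)"
  proof (rule sum.mono_neutral_right)
    show "\<forall>k\<in>{..Suc (length w)} - {1}.
        log_multiplier a l (take k (i # w)) z * S (drop k (i # w)) z = 0"
    proof
      fix k assume "k \<in> {..Suc (length w)} - {1}"
      then have "k = 0 \<or> length (take k (i # w)) > 1" by auto
      then show "log_multiplier a l (take k (i # w)) z * S (drop k (i # w)) z = 0"
        using log_multiplier_longer[of "take k (i # w)" a l]
        by (auto simp: log_multiplier_Nil simp del: length_take take_Suc_Cons)
    qed
  qed auto
  finally show ?thesis by (simp add: log_multiplier_single)
qed

section \<open>Differentiating the pairing\<close>

text \<open>A nonempty word of \<open>A\<close> is \<open>i # w\<close> for exactly one pair, and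
  then \<open>w\<close> is in \<open>A\<close>; pairs with \<open>i # w\<close> outside
  \<open>A\<close> contribute zero. This undoes the shift by one letter that the differential
  equation causes.\<close>

lemma sum_suffix_closed:
  fixes f :: "'x::finite list \<Rightarrow> 'b::comm_monoid_add"
  assumes fin: "finite A" and closed: "\<And>i w. i # w \<in> A \<Longrightarrow> w \<in> A"
    and f0: "f [] = 0" and out: "\<And>w. w \<notin> A \<Longrightarrow> f w = 0"
  shows "sum f A = (\<Sum>w\<in>A. \<Sum>i\<in>UNIV. f (i # w))"
proof -
  let ?T = "{p \<in> A \<times> UNIV. snd p # fst p \<in> A}"
  have "(\<Sum>w\<in>A. \<Sum>i\<in>UNIV. f (i # w)) = (\<Sum>p\<in>A \<times> UNIV. f (snd p # fst p))"
    by (simp add: sum.cartesian_product case_prod_beta)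
  also have "\<dots> = (\<Sum>p\<in>?T. f (snd p # fst p))"
    by (rule sum.mono_neutral_right) (use fin out in auto)
  also have "\<dots> = sum f (A - {[]})"
  proof (rule sum.reindex_bij_witness[of _ "\<lambda>u. (tl u, hd u)" "\<lambda>p. snd p # fst p"])
    fix u assume "u \<in> A - {[]}"
    then show "(tl u, hd u) \<in> ?T" using closed[of "hd u" "tl u"] by auto
  qed auto
  also have "\<dots> = sum f A"
    by (rule sum.mono_neutral_left) (use fin f0 in auto)
  finally show ?thesis ..
qed

text \<open>The polynomial \<open>Q\<close> with \<open>\<langle>S | P\<rangle>' = \<langle>S | Q\<rangle>\<close> for every solution \<open>S\<close> of the equation.\<close>

definition dual_deriv ::
    "('x::finite \<Rightarrow> complex) \<Rightarrow> ('x \<Rightarrow> complex) \<Rightarrow> ('x, complex \<Rightarrow> complex) ncseries \<Rightarrow>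
      ('x, complex \<Rightarrow> complex) ncseries" where
  "dual_deriv a l P = (\<lambda>w z. deriv (P w) z + (\<Sum>i\<in>UNIV. l i / (z - a i) * P (i # w) z))"

lemma deriv_eq_on_open:
  assumes "open U" "z \<in> U" "\<And>x. x \<in> U \<Longrightarrow> f x = g x"
  shows "deriv f z = deriv g z"
  by (rule deriv_cong_ev) (use assms eventually_nhds in blast, simp)

lemma nc_solution_on_subset:
  assumes "nc_solution_on V M S" "U \<subseteq> V"
  shows "nc_solution_on U M S"
  using assms unfolding nc_solution_on_def by (meson holomorphic_on_subset subsetD)

text \<open>Product rule, followed by the equation for the derivatives of \<open>S\<close>. Summing
  over a fixed suffix-closed set instead of the support of \<open>P\<close> lets both halves of the
  product rule be collected over the same words.\<close>

lemma sum_dual_deriv_eq_0: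
  fixes S P :: "('x::finite, complex \<Rightarrow> complex) ncseries"
  assumes U: "open U" and sol: "nc_solution_on U (log_multiplier a l) S"
    and P: "\<And>w. P w holomorphic_on U"
    and fin: "finite A" and closed: "\<And>i w. i # w \<in> A \<Longrightarrow> w \<in> A"
    and supp: "\<And>w z. w \<notin> A \<Longrightarrow> z \<in> U \<Longrightarrow> P w z = 0"
    and zero: "\<And>z. z \<in> U \<Longrightarrow> (\<Sum>w\<in>A. S w z * P w z) = 0"
    and z: "z \<in> U"
  shows "(\<Sum>w\<in>A. S w z * dual_deriv a l P w z) = 0"
proof -
  have S: "S w holomorphic_on U" for w
    using sol by (simp add: nc_solution_on_def)
  have dS: "deriv (S w) z = nc_mult (log_multiplier a l) S w z" for w
    using sol z by (simp add: nc_solution_on_def nc_deriv_def)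
  have "((\<lambda>z. \<Sum>w\<in>A. S w z * P w z) has_field_derivative
      (\<Sum>w\<in>A. deriv (S w) z * P w z + S w z * deriv (P w) z)) (at z)"
    by (rule derivative_eq_intros holomorphic_derivI[OF S U z] holomorphic_derivI[OF P U z] refl
        | simp add: algebra_simps)+
  then have "(\<Sum>w\<in>A. deriv (S w) z * P w z + S w z * deriv (P w) z) =
      deriv (\<lambda>z. \<Sum>w\<in>A. S w z * P w z) z"
    by (simp add: DERIV_imp_deriv)
  also have "\<dots> = deriv (\<lambda>z. 0) z"
    using U z zero by (rule deriv_eq_on_open)
  finally have "(\<Sum>w\<in>A. deriv (S w) z * P w z) + (\<Sum>w\<in>A. S w z * deriv (P w) z) = 0"
    by (simp add: sum.distrib)
  \<comment> \<open>The term at the empty word vanishes because \<open>S []\<close> has derivative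
    zero.\<close>
  moreover have "(\<Sum>w\<in>A. deriv (S w) z * P w z) =
      (\<Sum>w\<in>A. \<Sum>i\<in>UNIV. deriv (S (i # w)) z * P (i # w) z)"
    using fin closed supp[OF _ z]
    by (intro sum_suffix_closed) (auto simp: dS nc_mult_log_multiplier_Nil)
  ultimately show ?thesis
    by (simp add: dS nc_mult_log_multiplier_Cons dual_deriv_def distrib_left sum.distrib
        sum_distrib_left mult_ac add.commute)
qed

section \<open>Closure properties of a differential field of germs\<close>

lemma
  assumes C: "differential_field_of_germs V B C" and U: "U \<in> B"
  shows germs_nonempty: "U \<noteq> {}"
    and germs_open: "open U"
    and germs_connected: "connected U"
    and germs_subset: "U \<subseteq> V"
    and germs_cong: "f \<in> C U \<Longrightarrow> (\<And>z. z \<in> U \<Longrightarrow> g z = f z) \<Longrightarrow> g \<in> C U"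
    and germs_holomorphic: "f \<in> C U \<Longrightarrow> f holomorphic_on U"
    and germs_diff: "f \<in> C U \<Longrightarrow> g \<in> C U \<Longrightarrow> f - g \<in> C U"
    and germs_times: "f \<in> C U \<Longrightarrow> g \<in> C U \<Longrightarrow> f * g \<in> C U"
    and germs_deriv: "f \<in> C U \<Longrightarrow> deriv f \<in> C U"
    and germs_restrict: "W \<in> B \<Longrightarrow> W \<subseteq> U \<Longrightarrow> f \<in> C U \<Longrightarrow> f \<in> C W"
    and germs_inverse: "f \<in> C U \<Longrightarrow> z \<in> U \<Longrightarrow> f z \<noteq> 0 \<Longrightarrow>
      \<exists>W\<in>B. W \<subseteq> U - {z. f z = 0} \<and> (\<lambda>z. inverse (f z)) \<in> C W"
proof -
  note D = C[unfolded differential_field_of_germs_def filter_basis_def]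
  have 1: "{} \<notin> B" using D by (elim conjE)
  have 2: "\<forall>U\<in>B. open U \<and> connected U \<and> U \<subseteq> V" using D by (elim conjE)
  have 3: "\<forall>U\<in>B. \<forall>f\<in>C U. \<forall>g. (\<forall>z\<in>U. g z = f z) \<longrightarrow> g \<in> C U" using D by (elim conjE)
  have 4: "\<forall>U\<in>B. \<forall>f\<in>C U. f holomorphic_on U" using D by (elim conjE)
  have 5: "\<forall>U\<in>B. \<forall>f\<in>C U. \<forall>g\<in>C U. f - g \<in> C U \<and> f * g \<in> C U" using D by (elim conjE)
  have 6: "\<forall>U\<in>B. \<forall>f\<in>C U. deriv f \<in> C U" using D by (elim conjE)
  have 7: "\<forall>U\<in>B. \<forall>W\<in>B. W \<subseteq> U \<longrightarrow> C U \<subseteq> C W" using D by (elim conjE)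
  have 8: "\<forall>U\<in>B. \<forall>f\<in>C U. (\<exists>z\<in>U. f z \<noteq> 0) \<longrightarrow>
      (\<exists>W\<in>B. W \<subseteq> U - {z. f z = 0} \<and> (\<lambda>z. inverse (f z)) \<in> C W)" using D by (elim conjE)
  show "U \<noteq> {}" using 1 U by metis
  show "open U" "connected U" "U \<subseteq> V" using 2 U by simp_all
  show "g \<in> C U" if "f \<in> C U" "\<And>z. z \<in> U \<Longrightarrow> g z = f z"
    using 3 U that by simp
  show "f holomorphic_on U" "deriv f \<in> C U" if "f \<in> C U"
    using 4 6 U that by simp_all
  show "f - g \<in> C U" "f * g \<in> C U" if "f \<in> C U" "g \<in> C U"
    using 5 U that by simp_all
  show "f \<in> C W" if "W \<in> B" "W \<subseteq> U" "f \<in> C U"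
    using 7[rule_format, OF U that(1,2)] that(3) by (rule subsetD)
  show "\<exists>W\<in>B. W \<subseteq> U - {z. f z = 0} \<and> (\<lambda>z. inverse (f z)) \<in> C W"
    if "f \<in> C U" "z \<in> U" "f z \<noteq> 0"
    using that by (intro 8[rule_format, OF U]) blast+
qed

lemma germs_add:
  assumes "differential_field_of_germs V B C" "U \<in> B" "f \<in> C U" "g \<in> C U"
  shows "(\<lambda>z. f z + g z) \<in> C U"
proof -
  \<comment> \<open>The ring axioms are stated with differences; \<open>g - g - g\<close> is the
    negative of \<open>g\<close>.\<close>
  have "f - (g - g - g) \<in> C U"
    by (intro germs_diff[OF assms(1,2)] assms(3,4))
  also have "f - (g - g - g) = (\<lambda>z. f z + g z)"
    by (auto simp: fun_eq_iff)
  finally show ?thesis .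
qed

lemma germs_mult:
  assumes "differential_field_of_germs V B C" "U \<in> B" "f \<in> C U" "g \<in> C U"
  shows "(\<lambda>z. f z * g z) \<in> C U"
  using germs_times[OF assms] by (simp add: times_fun_def)

lemma germs_sum:
  assumes "differential_field_of_germs V B C" "U \<in> B" "(\<lambda>z. 0) \<in> C U"
    and "\<And>i. i \<in> I \<Longrightarrow> f i \<in> C U"
  shows "(\<lambda>z. \<Sum>i\<in>I. f i z) \<in> C U"
  using assms(4)
  by (induction I rule: infinite_finite_induct) (auto intro: germs_add assms(1-3))

lemma germs_prod:
  assumes "differential_field_of_germs V B C" "U \<in> B" "(\<lambda>z. 1) \<in> C U"
    and "\<And>i. i \<in> I \<Longrightarrow> f i \<in> C U"
  shows "(\<lambda>z. \<Prod>i\<in>I. f i z) \<in> C U"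
  using assms(4)
  by (induction I rule: infinite_finite_induct) (auto intro: germs_mult assms(1-3))

text \<open>The functions \<open>1 / (z - a i)\<close> are only guaranteed to lie in the field on
  some smaller domain. Multiplying by the common denominator leaves polynomials in \<open>z\<close>,
  so the domain need not shrink.\<close>

lemma germs_dual_deriv:
  fixes P :: "('x::finite, complex \<Rightarrow> complex) ncseries"
  assumes C: "differential_field_of_germs V B C" and U: "U \<in> B" "U \<subseteq> - range a"
    and z: "(\<lambda>z. z) \<in> C U" and const: "\<And>c. (\<lambda>z. c) \<in> C U"
    and P: "\<And>w. P w \<in> C U"
  shows "(\<lambda>z. (\<Prod>i\<in>UNIV. z - a i) * dual_deriv a l P w z) \<in> C U"
proof -
  let ?f = "\<lambda>z. (\<Prod>i\<in>UNIV. z - a i) * deriv (P w) z +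
      (\<Sum>i\<in>UNIV. l i * ((\<Prod>j\<in>UNIV - {i}. z - a j) * P (i # w) z))"
  have lin: "(\<lambda>z. z - c) \<in> C U" for c
    using germs_add[OF C U(1) z const[of "- c"]] by simp
  have prods: "(\<lambda>z. \<Prod>i\<in>I. z - a i) \<in> C U" for I
    using lin by (rule germs_prod[OF C U(1) const])
  have "(\<lambda>z. l i * ((\<Prod>j\<in>UNIV - {i}. z - a j) * P (i # w) z)) \<in> C U" for i
    using germs_mult[OF C U(1) const germs_mult[OF C U(1) prods P]] .
  then have "(\<lambda>z. \<Sum>i\<in>UNIV. l i * ((\<Prod>j\<in>UNIV - {i}. z - a j) * P (i # w) z)) \<in> C U"
    by (rule germs_sum[OF C U(1) const])
  then have "?f \<in> C U"
    by (rule germs_add[OF C U(1) germs_mult[OF C U(1) prods germs_deriv[OF C U(1) P]]])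
  moreover have "(\<Prod>i\<in>UNIV. z - a i) * dual_deriv a l P w z = ?f z" if "z \<in> U" for z
  proof -
    have "(\<Prod>j\<in>UNIV. z - a j) * (l i / (z - a i) * p) =
        l i * ((\<Prod>j\<in>UNIV - {i}. z - a j) * p)" for i p
      using that U(2) prod.remove[of UNIV i "\<lambda>j. z - a j"] by auto
    then show ?thesis
      by (simp add: dual_deriv_def distrib_left sum_distrib_left)
  qed
  ultimately show ?thesis by (rule germs_cong[OF C U(1)])
qed

section \<open>Branches of the logarithm and their combinations\<close>

lemma log_branch_on_deriv:
  assumes "log_branch_on U a L" "open U" "z \<in> U"
  shows "(L has_field_derivative 1 / (z - a)) (at z)"
proof -
  have holo: "L holomorphic_on U" and L: "\<And>x. x \<in> U \<Longrightarrow> exp (L x) = x - a"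
    using assms(1) by (auto simp: log_branch_on_def)
  have D: "(L has_field_derivative deriv L z) (at z)"
    using holo assms(2,3) by (rule holomorphic_derivI)
  then have "((\<lambda>x. exp (L x)) has_field_derivative exp (L z) * deriv L z) (at z)"
    by (rule DERIV_fun_exp)
  then have "exp (L z) * deriv L z = deriv (\<lambda>x. exp (L x)) z"
    by (simp add: DERIV_imp_deriv)
  also have "\<dots> = deriv (\<lambda>x. x - a) z"
    using assms(2,3) L by (rule deriv_eq_on_open)
  also have "\<dots> = 1"
    by (rule DERIV_imp_deriv) (auto intro!: derivative_eq_intros)
  finally have "deriv L z = 1 / (z - a)"
    using L[OF assms(3)] by (metis exp_not_eq_zero nonzero_eq_divide_eq mult.commute)
  with D show ?thesis by simp
qed

text \<open>The branch is built on \<open>V\<close>, where \<open>z - a\<close> has no zero, and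
  then restricted, since \<open>U\<close> itself may fail to be simply connected.\<close>

lemma log_branch_exists:
  assumes "simply_connected V" "open V" "a \<notin> V" "U \<subseteq> V"
  obtains L where "log_branch_on U a L"
proof -
  obtain L where "L holomorphic_on V" "\<And>z. z \<in> V \<Longrightarrow> z - a = exp (L z)"
    by (rule simply_connected_imp_holomorphic_log[of "\<lambda>z. z - a" V])
      (use assms in \<open>auto intro!: holomorphic_intros open_imp_locally_path_connected\<close>)
  then have "log_branch_on U a L"
    using assms(4) by (auto simp: log_branch_on_def intro: holomorphic_on_subset)
  then show ?thesis by (rule that)
qed

text \<open>The difference of \<open>f\<close> and the logarithmic sum has derivative zero on a
  connected open set.\<close>

lemma combination_of_logs:
  fixes a :: "'x::finite \<Rightarrow> complex"
  assumes U: "open U" "connected U" and L: "\<And>i. log_branch_on U (a i) (L i)"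
    and f: "f holomorphic_on U"
    and df: "\<And>z. z \<in> U \<Longrightarrow> deriv f z = (\<Sum>i\<in>UNIV. c i / (z - a i))"
  obtains c0 where "\<And>z. z \<in> U \<Longrightarrow> f z = c0 + (\<Sum>i\<in>UNIV. c i * L i z)"
proof -
  have "((\<lambda>z. f z - (\<Sum>i\<in>UNIV. c i * L i z)) has_field_derivative 0) (at z)" if "z \<in> U" for z
    by (rule derivative_eq_intros holomorphic_derivI[OF f U(1) that]
        log_branch_on_deriv[OF L U(1) that] refl | simp add: df[OF that])+
  then have "(\<lambda>z. f z - (\<Sum>i\<in>UNIV. c i * L i z)) constant_on U"
    using U(2,1) by (rule has_field_derivative_0_imp_constant_on)
  then obtain c0 where "\<And>z. z \<in> U \<Longrightarrow> f z - (\<Sum>i\<in>UNIV. c i * L i z) = c0"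
    by (auto simp: constant_on_def)
  then have "f z = c0 + (\<Sum>i\<in>UNIV. c i * L i z)" if "z \<in> U" for z
    using that by (metis diff_eq_eq)
  then show ?thesis by (rule that)
qed

text \<open>The multiplier has no constant term, so \<open>S []\<close> has derivative zero and is
  constant on \<open>V\<close>.\<close>

lemma regular_solution_Nil_nonzero:
  assumes "nc_solution_on V (log_multiplier a l) S" "regular_on V S"
    and V: "open V" "connected V" "z \<in> V"
  shows "S [] z \<noteq> 0"
proof -
  have "(S [] has_field_derivative 0) (at x)" if "x \<in> V" for x
    using assms(1) holomorphic_derivI[of "S []" V x] V(1) that
    by (auto simp: nc_solution_on_def nc_deriv_def nc_mult_log_multiplier_Nil)
  then have "S [] constant_on V"
    using V(2,1) by (rule has_field_derivative_0_imp_constant_on)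
  with assms(2) V(3) show ?thesis
    by (auto simp: regular_on_def constant_on_def)
qed

section \<open>Impossibility of a normalised relation\<close>

text \<open>If the longest word \<open>u\<close> is empty, the relation reads
  \<open>S [] = 0\<close>, against regularity. If \<open>u = i0 # v\<close>, the coefficient of
  \<open>v\<close> is a forbidden combination of logarithms.\<close>

lemma normalised_contradiction:
  fixes a l :: "'x::finite \<Rightarrow> complex"
  assumes V: "open V" "simply_connected V" "V \<subseteq> - range a"
    and l: "\<forall>i. l i \<noteq> 0"
    and sol: "nc_solution_on V (log_multiplier a l) S" and reg: "regular_on V S"
    and C: "differential_field_of_germs V B C"
    and no_log: "\<forall>U\<in>B. \<forall>L c0 c. (\<forall>i. log_branch_on U (a i) (L i)) \<longrightarrow> (\<exists>i. c i \<noteq> 0) \<longrightarrow>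
            (\<lambda>z. c0 + (\<Sum>i\<in>UNIV. c i * L i z)) \<notin> C U"
    and U: "U \<in> B" and P: "\<And>w. P w \<in> C U"
    and fin: "finite A" and u: "u \<in> A" "\<And>w. w \<in> A \<Longrightarrow> length w \<le> length u"
    and supp: "\<And>w z. w \<notin> A \<Longrightarrow> z \<in> U \<Longrightarrow> P w z = 0"
    and one: "\<And>z. z \<in> U \<Longrightarrow> P u z = 1"
    and zero: "\<And>z. z \<in> U \<Longrightarrow> (\<Sum>w\<in>A. S w z * P w z) = 0"
    and dual: "\<And>w z. z \<in> U \<Longrightarrow> dual_deriv a l P w z = 0"
  shows False
proof (cases u)
  case Nil
  obtain z where z: "z \<in> U" "z \<in> V"
    using germs_nonempty[OF C U] germs_subset[OF C U] by blast
  have "A = {[]}" using u Nil by fastforce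
  then have "S [] z = 0" using zero[OF z(1)] one[OF z(1)] Nil by simp
  moreover have "S [] z \<noteq> 0"
    using sol reg V z by (intro regular_solution_Nil_nonzero simply_connected_imp_connected)
  ultimately show False by simp
next
  case (Cons i0 v)
  note UV = germs_open[OF C U] germs_connected[OF C U] germs_subset[OF C U]
    and holo = germs_holomorphic[OF C U]
  \<comment> \<open>The words \<open>j # i # v\<close> are longer than \<open>u\<close>, hence
    outside \<open>A\<close>, so the dual derivative at \<open>i # v\<close> is just the derivative
    of \<open>P (i # v)\<close>.\<close>
  have "P (i # v) constant_on U" for i
  proof (rule has_field_derivative_0_imp_constant_on)
    fix z assume z: "z \<in> U"
    have "P (j # i # v) z = 0" for j
      using supp[OF _ z] u(2)[of "j # i # v"] Cons by force
    with dual[OF z, of "i # v"] have "deriv (P (i # v)) z = 0"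
      by (simp add: dual_deriv_def)
    with holomorphic_derivI[OF holo[OF P] UV(1) z, of "i # v"]
    show "(P (i # v) has_field_derivative 0) (at z)" by simp
  qed (use UV in auto)
  then have "\<exists>c. \<forall>z\<in>U. P (i # v) z = c" for i
    by (simp add: constant_on_def)
  then obtain c where c: "\<And>i z. z \<in> U \<Longrightarrow> P (i # v) z = c i"
    by metis
  have "\<exists>L. log_branch_on U (a i) L" for i
    using log_branch_exists[of V "a i" U] V UV(3) by blast
  then obtain L where L: "\<And>i. log_branch_on U (a i) (L i)"
    by metis
  have "deriv (P v) z = (\<Sum>i\<in>UNIV. - l i * c i / (z - a i))" if "z \<in> U" for z
    using dual[OF that, of v] by (simp add: dual_deriv_def c[OF that] sum_negf eq_neg_iff_add_eq_0)
  then obtain c0 where "\<And>z. z \<in> U \<Longrightarrow> P v z = c0 + (\<Sum>i\<in>UNIV. - l i * c i * L i z)"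
    using combination_of_logs[of U a L "P v" "\<lambda>i. - l i * c i"] UV(1,2) L holo[OF P] by blast
  then have "(\<lambda>z. c0 + (\<Sum>i\<in>UNIV. - l i * c i * L i z)) \<in> C U"
    by (intro germs_cong[OF C U P[of v]]) simp
  moreover obtain z where "z \<in> U" using germs_nonempty[OF C U] by blast
  \<comment> \<open>As \<open>i0 # v\<close> is \<open>u\<close>, the normalisation makes the
    coefficient of the logarithm at \<open>a i0\<close> equal to \<open>- l i0\<close>, which is
    nonzero.\<close>
  then have "c i0 = 1" using c one Cons by metis
  then have "\<exists>i. - l i * c i \<noteq> 0" using l by (metis mult_cancel_left2 neg_equal_0_iff_equal)
  ultimately show False
    using no_log[rule_format, of U L "\<lambda>i. - l i * c i" c0] U L by blast
qed

section \<open>Induction on the set of words\<close>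

text \<open>The induction removes a longest word from \<open>A\<close>, which keeps \<open>A\<close>
  suffix-closed. The domain \<open>U\<close> must be arbitrary because normalising the leading
  coefficient replaces it by a smaller one.\<close>

lemma independence_on_suffix_closed:
  fixes a l :: "'x::finite \<Rightarrow> complex"
  assumes V: "open V" "simply_connected V" "V \<subseteq> - range a"
    and l: "\<forall>i. l i \<noteq> 0"
    and sol: "nc_solution_on V (log_multiplier a l) S" and reg: "regular_on V S"
    and C: "differential_field_of_germs V B C"
    and z: "\<forall>U\<in>B. (\<lambda>z. z) \<in> C U" and const: "\<forall>U\<in>B. \<forall>c. (\<lambda>z. c) \<in> C U"
    and no_log: "\<forall>U\<in>B. \<forall>L c0 c. (\<forall>i. log_branch_on U (a i) (L i)) \<longrightarrow> (\<exists>i. c i \<noteq> 0) \<longrightarrow>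
            (\<lambda>z. c0 + (\<Sum>i\<in>UNIV. c i * L i z)) \<notin> C U"
    and "finite A" "\<And>i w. i # w \<in> A \<Longrightarrow> w \<in> A"
    and "U \<in> B" "\<And>w. P w \<in> C U"
    and "\<And>w z. w \<notin> A \<Longrightarrow> z \<in> U \<Longrightarrow> P w z = 0"
    and "\<And>z. z \<in> U \<Longrightarrow> (\<Sum>w\<in>A. S w z * P w z) = 0"
    and "z \<in> U"
  shows "P w z = 0"
  using assms(11-)
proof (induction A arbitrary: U P w z rule: finite_psubset_induct)
  case (psubset A)
  note IH = psubset.IH and closed = psubset.prems(1) and U = psubset.prems(2)
    and P = psubset.prems(3) and supp = psubset.prems(4) and zero = psubset.prems(5)
  show ?case
  proof (cases "A = {}")
    case True
    with supp psubset.prems(6) show ?thesis by simp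
  next
    case False
    define m where "m = Max (length ` A)"
    have "m \<in> length ` A"
      unfolding m_def by (rule Max_in) (use False psubset.hyps in auto)
    then obtain u where u: "u \<in> A" "length u = m"
      by auto
    have long: "length w \<le> length u" if "w \<in> A" for w
      using u(2) that psubset.hyps by (simp add: m_def)
    have smaller: "A - {u} \<subset> A" using u by auto
    \<comment> \<open>The longest word \<open>u\<close> cannot be the tail of a word in
      \<open>A\<close>.\<close>
    have closed': "w \<in> A - {u}" if "i # w \<in> A - {u}" for i w
      using that closed[of i w] long[of "i # w"] by auto
    have drop_u: "(\<Sum>w\<in>A - {u}. S w x * R w x) = (\<Sum>w\<in>A. S w x * R w x)"
      if "R u x = 0" for R and x :: complex
      using psubset.hyps u(1) that by (simp add: sum.remove[of A u])
    show ?thesis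
    proof (cases "\<exists>x\<in>U. P u x \<noteq> 0")
      \<comment> \<open>The coefficient of \<open>u\<close> vanishes on \<open>U\<close>, so the
        same \<open>P\<close> is already supported on \<open>A - {u}\<close>.\<close>
      case False
      show ?thesis
      proof (rule IH[OF smaller closed' U P _ _ psubset.prems(6)])
        show "P w x = 0" if "w \<notin> A - {u}" "x \<in> U" for w x
          using that False supp by auto
        show "(\<Sum>w\<in>A - {u}. S w x * P w x) = 0" if "x \<in> U" for x
          using that False zero by (subst drop_u) auto
      qed
    next
      case True
      \<comment> \<open>Invertibility of \<open>P u\<close> on some \<open>W\<close> allows division
        by it; the quotient \<open>N\<close> has leading coefficient \<open>1\<close>.\<close>
      obtain W where W: "W \<in> B" "W \<subseteq> U - {x. P u x = 0}" "(\<lambda>x. inverse (P u x)) \<in> C W"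
        using germs_inverse[OF C U P[of u]] True by blast
      have WU: "W \<subseteq> U" and nz: "\<And>x. x \<in> W \<Longrightarrow> P u x \<noteq> 0" using W(2) by auto
      note Wo = germs_open[OF C W(1)] germs_subset[OF C W(1)]
      have Wa: "W \<subseteq> - range a" using Wo(2) V(3) by auto
      define N where "N = (\<lambda>w x. inverse (P u x) * P w x)"
      have N: "N w \<in> C W" for w
        unfolding N_def by (intro germs_mult[OF C W(1) W(3)] germs_restrict[OF C U W(1) WU] P)
      have N_supp: "N w x = 0" if "w \<notin> A" "x \<in> W" for w x
        using that supp WU by (auto simp: N_def)
      have N_one: "N u x = 1" if "x \<in> W" for x
        using nz[OF that] by (simp add: N_def)
      have N_zero: "(\<Sum>w\<in>A. S w x * N w x) = 0" if "x \<in> W" for x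
      proof -
        have "(\<Sum>w\<in>A. S w x * N w x) = inverse (P u x) * (\<Sum>w\<in>A. S w x * P w x)"
          by (simp add: N_def sum_distrib_left mult_ac)
        then show ?thesis using zero that WU by auto
      qed
      have sum_dual: "(\<Sum>w\<in>A. S w x * dual_deriv a l N w x) = 0" if "x \<in> W" for x
        using Wo(1) nc_solution_on_subset[OF sol Wo(2)] _ psubset.hyps closed N_supp N_zero that
        by (rule sum_dual_deriv_eq_0) (use germs_holomorphic[OF C W(1) N] in auto)
      \<comment> \<open>On \<open>W\<close> these coefficients are constant: \<open>1\<close> at
        \<open>u\<close>, and \<open>0\<close> outside \<open>A\<close>.\<close>
      have N_deriv: "deriv (N w) x = 0" if "w \<notin> A - {u}" "x \<in> W" for w x
      proof -
        have "deriv (N w) x = deriv (\<lambda>x. if w = u then 1 else 0) x"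
          using Wo(1) that(2) by (rule deriv_eq_on_open) (use N_supp N_one that(1) in auto)
        then show ?thesis by simp
      qed
      have dual_supp: "dual_deriv a l N w x = 0" if "w \<notin> A - {u}" "x \<in> W" for w x
      proof -
        \<comment> \<open>For \<open>w\<close> outside \<open>A\<close> by suffix-closure, for
          \<open>w = u\<close> by maximality of its length.\<close>
        have "i # w \<notin> A" for i
          using that(1) closed[of i w] long[of "i # w"] by auto
        then show ?thesis
          using N_deriv[OF that] N_supp that(2) by (simp add: dual_deriv_def)
      qed
      have dual: "dual_deriv a l N w x = 0" if "x \<in> W" for w x
      proof -
        \<comment> \<open>Clearing denominators puts the dual derivative into \<open>C W\<close>, so
          that the induction hypothesis applies to it on \<open>A - {u}\<close> and
          \<open>W\<close>.\<close>
        define R where "R = (\<lambda>w x. (\<Prod>i\<in>UNIV. x - a i) * dual_deriv a l N w x)"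
        have "R w x = 0"
        proof (rule IH[where P = R, OF smaller closed' W(1) _ _ _ that])
          show "R w \<in> C W" for w
            unfolding R_def using z const W(1) by (intro germs_dual_deriv[OF C W(1) Wa _ _ N]) auto
          show "R w x = 0" if "w \<notin> A - {u}" "x \<in> W" for w x
            using dual_supp[OF that] by (simp add: R_def)
          show "(\<Sum>w\<in>A - {u}. S w x * R w x) = 0" if "x \<in> W" for x
          proof -
            have "(\<Sum>w\<in>A. S w x * R w x) =
                (\<Prod>i\<in>UNIV. x - a i) * (\<Sum>w\<in>A. S w x * dual_deriv a l N w x)"
              by (simp add: R_def sum_distrib_left mult_ac)
            then show ?thesis
              using sum_dual that dual_supp[of u x] by (subst drop_u) (auto simp: R_def)
          qed
        qed
        \<comment> \<open>The product has no zero on \<open>W\<close>, which avoids all the points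
          \<open>a i\<close>.\<close>
        then show ?thesis using that Wa by (auto simp: R_def)
      qed
      have False
        using V l sol reg C no_log W(1) N psubset.hyps u(1) long N_supp N_one N_zero dual
        by (rule normalised_contradiction)
      then show ?thesis ..
    qed
  qed
qed

section \<open>From polynomials to suffix-closed sets of words\<close>

theorem theorem2:
  fixes a l :: "'x::finite \<Rightarrow> complex"
    and V :: "complex set"
    and S :: "('x, complex \<Rightarrow> complex) ncseries"
    and B :: "complex set set"
    and C :: "complex set \<Rightarrow> (complex \<Rightarrow> complex) set"
  assumes "inj a"
    and "V \<noteq> {}" "open V" "simply_connected V" "V \<subseteq> - range a"
    and "\<forall>i. l i \<noteq> 0"
    and "nc_solution_on V (log_multiplier a l) S" "regular_on V S"
    and "differential_field_of_germs V B C"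
    and "\<forall>U\<in>B. (\<lambda>z. z) \<in> C U"
    and "\<forall>U\<in>B. \<forall>c. (\<lambda>z. c) \<in> C U"
    and no_log: "\<forall>U\<in>B. \<forall>L c0 c. (\<forall>i. log_branch_on U (a i) (L i)) \<longrightarrow> (\<exists>i. c i \<noteq> 0) \<longrightarrow>
            (\<lambda>z. c0 + (\<Sum>i\<in>UNIV. c i * L i z)) \<notin> C U"
  shows "\<forall>U\<in>B. \<forall>P :: ('x, complex \<Rightarrow> complex) ncseries.
           nc_polynomial P \<longrightarrow> (\<forall>w. P w \<in> C U) \<longrightarrow>
           (\<forall>z\<in>U. nc_pairing S P z = 0) \<longrightarrow> (\<forall>w. \<forall>z\<in>U. P w z = 0)"
proof (intro ballI allI impI)
  fix U w z and P :: "('x, complex \<Rightarrow> complex) ncseries"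
  assume U: "U \<in> B" and poly: "nc_polynomial P" and P: "\<forall>w. P w \<in> C U"
    and zero: "\<forall>z\<in>U. nc_pairing S P z = 0" and z: "z \<in> U"
  have fin: "finite {w. P w \<noteq> 0}" using poly by (simp add: nc_polynomial_def)
  \<comment> \<open>All words up to the degree of \<open>P\<close>: finite because the alphabet is
    finite, and suffix-closed, unlike the support. For empty support the bound is the unspecified
    number \<open>Max {}\<close>, and any bound will do.\<close>
  define A where "A = {w :: 'x list. length w \<le> Max (length ` {w. P w \<noteq> 0})}"
  have finA: "finite A"
    using finite_lists_length_le[of "UNIV :: 'x set"] by (simp add: A_def)
  have supp: "{w. P w \<noteq> 0} \<subseteq> A" using fin by (auto simp: A_def)
  have sum0: "(\<Sum>w\<in>A. S w x * P w x) = 0" if "x \<in> U" for x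
  proof -
    have "(\<Sum>w\<in>A. S w x * P w x) = (\<Sum>w | P w \<noteq> 0. S w x * P w x)"
      by (rule sum.mono_neutral_right) (use finA supp in auto)
    then show ?thesis using zero that by (simp add: nc_pairing_def sum_fun_apply)
  qed
  have out: "P w x = 0" if "w \<notin> A" for w x
    using that supp by (metis (mono_tags) mem_Collect_eq subsetD zero_fun_apply)
  have closed: "w \<in> A" if "i # w \<in> A" for i w
    using that by (simp add: A_def)
  show "P w z = 0"
    by (rule independence_on_suffix_closed[OF assms(3-11) no_log finA closed U _ out sum0 z])
      (use P in auto)
qed

end
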